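(* Let $k$ be an algebraically closed field of characteristic $\neq2$, let $V$ be a $7$-dimensional $k$-vector space, and let $\gamma$ and $\beta$ be compatible alternating trilinear and nondegenerate symmetric bilinear forms on $V$, defining an octonion algebra $C=k\oplus V$; let $G=\mathrm{Aut}(C)$. Let $V=L_1\oplus\cdots\oplus L_7$ be a splitting into one-dimensional subspaces such that $L_1$ is $\gamma$-isotropic, and $L_1\oplus L_2\oplus L_3=E_u$ for a generator $u\in L_1$. Then the map $V\otimes V\to V^*\cong V$ induced by $\gamma$ (with $V^*\cong V$ given by $\beta$) restricts to a $G$-equivariant isomorphism $L_2\otimes L_3\xrightarrow{\sim}L_1$.
   Context: For a nondegenerate $\beta$, $\dagger:V^*\to V$ is the inverse of $v\mapsto\beta(v,\cdot)$. $\gamma$ and $\beta$ are compatible if $2\gamma(u,v,\gamma(u,v,\cdot)^\dagger)=\beta(u,u)\beta(v,v)-\beta(u,v)^2$ for all $u,v\in V$. In that case $C=k\oplus V$ (with $e=1\in k$ as identity) is an octonion algebra under $uv=-\frac12\beta(u,v)e+\gamma(u,v,\cdot)^\dagger$ for $u,v\in V$; $G=\mathrm{Aut}(C)$ is simple of type $G_2$, acts on $V$, and preserves $\gamma$ and $\beta$. The map induced by $\gamma$ is $v\otimes w\mapsto\gamma(v,w,\cdot)^\dagger$. A subspace of dimension $\ge2$ is $\gamma$-isotropic if $\gamma(u,v,\cdot)\equiv0$ for all $u,v$ in it; a vector or line is $\gamma$-isotropic if it lies in a $2$-dimensional $\gamma$-isotropic subspace. For a nonzero isotropic $u$, $E_u=\{v\in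 V\mid\langle u,v\rangle\text{ is }\gamma\text{-isotropic}\}=\{v\in V\mid\gamma(u,v,\cdot)\equiv0\}$, a $3$-dimensional subspace. $G$-equivariance means: the map $V\otimes V\to V$ is $G$-equivariant, so for $g\in G$ the isomorphisms $L_2\otimes L_3\to L_1$ and $gL_2\otimes gL_3\to gL_1$ are intertwined by $g$. *)

theory Defs
  imports
    "HOL-Analysis.Product_Vector"
    "HOL-Computational_Algebra.Polynomial"
    "HOL-Library.Poly_Mapping"
    "HOL-Library.Set_Algebras"
    "HOL-Library.FuncSet"
begin

section \<open>Forms\<close>

definition symmetric_bilinear_form ::
    "('k::field \<Rightarrow> 'v::ab_group_add \<Rightarrow> 'v) \<Rightarrow> ('v \<Rightarrow> 'v \<Rightarrow> 'k) \<Rightarrow> bool" where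
  "symmetric_bilinear_form scl \<beta> \<longleftrightarrow>
     (\<forall>u. Vector_Spaces.linear scl (*) (\<lambda>v. \<beta> u v)) \<and>
     (\<forall>v. Vector_Spaces.linear scl (*) (\<lambda>u. \<beta> u v)) \<and>
     (\<forall>u v. \<beta> u v = \<beta> v u)"

definition nondegenerate :: "('v::zero \<Rightarrow> 'v \<Rightarrow> 'k::zero) \<Rightarrow> bool" where
  "nondegenerate \<beta> \<longleftrightarrow> (\<forall>v. (\<forall>w. \<beta> v w = 0) \<longrightarrow> v = 0)"

definition alternating_trilinear_form ::
    "('k::field \<Rightarrow> 'v::ab_group_add \<Rightarrow> 'v) \<Rightarrow> ('v \<Rightarrow> 'v \<Rightarrow> 'v \<Rightarrow> 'k) \<Rightarrow> bool" where
  "alternating_trilinear_form scl \<gamma> \<longleftrightarrow>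
     (\<forall>v w. Vector_Spaces.linear scl (*) (\<lambda>u. \<gamma> u v w)) \<and>
     (\<forall>u w. Vector_Spaces.linear scl (*) (\<lambda>v. \<gamma> u v w)) \<and>
     (\<forall>u v. Vector_Spaces.linear scl (*) (\<lambda>w. \<gamma> u v w)) \<and>
     (\<forall>u v. \<gamma> u u v = 0 \<and> \<gamma> u v u = 0 \<and> \<gamma> v u u = 0)"

text \<open>
  The inverse of \<open>v \<mapsto> \<beta>(v, \<cdot>)\<close>. It is meaningful on linear functionals only, and there
  for nondegenerate \<open>\<beta>\<close> on a finite-dimensional space.
\<close>
definition dagger :: "('v \<Rightarrow> 'v \<Rightarrow> 'k) \<Rightarrow> ('v \<Rightarrow> 'k) \<Rightarrow> 'v" where
  "dagger \<beta> = inv \<beta>"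

definition compatible :: "('v \<Rightarrow> 'v \<Rightarrow> 'k::field) \<Rightarrow> ('v \<Rightarrow> 'v \<Rightarrow> 'v \<Rightarrow> 'k) \<Rightarrow> bool" where
  "compatible \<beta> \<gamma> \<longleftrightarrow>
     (\<forall>u v. 2 * \<gamma> u v (dagger \<beta> (\<lambda>w. \<gamma> u v w)) = \<beta> u u * \<beta> v v - (\<beta> u v)\<^sup>2)"

section \<open>The algebra \<open>C = k \<oplus> V\<close> and its automorphism group\<close>

text \<open>
  The pair \<open>(a, v)\<close> stands for \<open>a e + v\<close>. The product is the bilinear extension of
  \<open>u v = -1/2 \<beta>(u,v) e + \<gamma>(u,v,\<cdot>)\<^sup>\<dagger>\<close> for which \<open>e = (1, 0)\<close> is the identity.
\<close>
definition oct_mult ::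
    "('k::field \<Rightarrow> 'v::ab_group_add \<Rightarrow> 'v) \<Rightarrow> ('v \<Rightarrow> 'v \<Rightarrow> 'k) \<Rightarrow> ('v \<Rightarrow> 'v \<Rightarrow> 'v \<Rightarrow> 'k)
      \<Rightarrow> 'k \<times> 'v \<Rightarrow> 'k \<times> 'v \<Rightarrow> 'k \<times> 'v" where
  "oct_mult scl \<beta> \<gamma> x y =
     (fst x * fst y - \<beta> (snd x) (snd y) / 2,
      scl (fst x) (snd y) + scl (fst y) (snd x) + dagger \<beta> (\<lambda>w. \<gamma> (snd x) (snd y) w))"

definition oct_aut ::
    "('k::field \<Rightarrow> 'v::ab_group_add \<Rightarrow> 'v) \<Rightarrow> ('v \<Rightarrow> 'v \<Rightarrow> 'k) \<Rightarrow> ('v \<Rightarrow> 'v \<Rightarrow> 'v \<Rightarrow> 'k)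
      \<Rightarrow> ('k \<times> 'v \<Rightarrow> 'k \<times> 'v) set" where
  "oct_aut scl \<beta> \<gamma> =
     {g. Vector_Spaces.linear (module_prod.scale (*) scl) (module_prod.scale (*) scl) g \<and>
         bij g \<and>
         (\<forall>x y. g (oct_mult scl \<beta> \<gamma> x y) = oct_mult scl \<beta> \<gamma> (g x) (g y))}"

text \<open>
  The action of an automorphism of \<open>C\<close> on \<open>V \<subseteq> C\<close>. By lemma \<open>oct_aut_act\<close> below, automorphisms
  preserve \<open>V\<close>, so the projection loses nothing.
\<close>
definition act :: "('k::zero \<times> 'v \<Rightarrow> 'k \<times> 'v) \<Rightarrow> 'v \<Rightarrow> 'v" where
  "act g v = snd (g (0, v))"

lemma dagger_zero:
  fixes scl :: "'k::field \<Rightarrow> 'v::ab_group_add \<Rightarrow> 'v"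
  assumes "symmetric_bilinear_form scl \<beta>" "nondegenerate \<beta>"
  shows "dagger \<beta> (\<lambda>w. 0) = 0"
proof -
  have lin: "Vector_Spaces.linear scl (*) (\<lambda>u. \<beta> u w)" for w
    using assms(1) by (simp add: symmetric_bilinear_form_def)
  have "inj \<beta>"
  proof (rule injI)
    fix x y assume "\<beta> x = \<beta> y"
    then have "\<beta> (x - y) w = 0" for w
      using module_hom.diff[OF Vector_Spaces.linear.axioms(3)[OF lin[of w]], of x y] by simp
    then show "x = y"
      using assms(2) unfolding nondegenerate_def by (metis eq_iff_diff_eq_0)
  qed
  moreover have "\<beta> 0 = (\<lambda>w. 0)"
    using module_hom.zero[OF Vector_Spaces.linear.axioms(3)[OF lin]] by (simp add: fun_eq_iff)
  ultimately show ?thesis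
    unfolding dagger_def by (metis inv_f_f)
qed

lemma oct_aut_act:
  fixes scl :: "'k::field \<Rightarrow> 'v::ab_group_add \<Rightarrow> 'v"
  assumes char: "CHAR('k) \<noteq> 2"
    and \<beta>: "symmetric_bilinear_form scl \<beta>" "nondegenerate \<beta>"
    and \<gamma>: "alternating_trilinear_form scl \<gamma>"
    and g: "g \<in> oct_aut scl \<beta> \<gamma>"
  shows "g (0, v) = (0, act g v)"
proof -
  have two: "(2::'k) \<noteq> 0"
  proof
    assume "(2::'k) = 0"
    then have "of_nat 2 = (0::'k)" by simp
    then have "CHAR('k) dvd 2" by (simp only: of_nat_eq_0_iff_char_dvd)
    then have "CHAR('k) = 1 \<or> CHAR('k) = 2"
      using prime_nat_iff two_is_prime_nat by blast
    with char show False by simp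
  qed
  have vs: "vector_space scl"
    using \<beta> by (auto simp: symmetric_bilinear_form_def Vector_Spaces.linear_def)
  interpret vector_space scl by (rule vs)
  interpret P: vector_space_prod "(*)" scl
    by (intro vector_space_prod.intro vector_space_pair.intro vs) (unfold_locales, auto simp: algebra_simps)
  have lb: "Vector_Spaces.linear scl (*) (\<lambda>v. \<beta> x v)"
      "Vector_Spaces.linear scl (*) (\<lambda>v. \<beta> v x)" for x
    using \<beta> by (simp_all add: symmetric_bilinear_form_def)
  have lc: "Vector_Spaces.linear scl (*) (\<lambda>v. \<gamma> x v w)"
      "Vector_Spaces.linear scl (*) (\<lambda>v. \<gamma> v x w)" for x w
    using \<gamma> by (simp_all add: alternating_trilinear_form_def)
  have b0: "\<beta> x 0 = 0" "\<beta> 0 x = 0" for x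
    using lb[THEN Vector_Spaces.linear.axioms(3), THEN module_hom.zero] by auto
  have c0: "\<gamma> x 0 w = 0" "\<gamma> 0 x w = 0" "\<gamma> x x w = 0" for x w
    using lc[THEN Vector_Spaces.linear.axioms(3), THEN module_hom.zero] \<gamma>
    by (auto simp: alternating_trilinear_form_def)
  note d0 = dagger_zero[OF \<beta>]
  let ?m = "oct_mult scl \<beta> \<gamma>"
  have lin: "Vector_Spaces.linear P.scale P.scale g" and bij: "bij g"
    and mult: "g (?m x y) = ?m (g x) (g y)" for x y
    using g unfolding oct_aut_def by blast+
  have e: "?m (1, 0) x = x" "?m x (1, 0) = x" for x
    by (simp_all add: oct_mult_def b0 c0 d0)
  obtain y where "g y = (1, 0)" using bij by (metis bij_pointE)
  then have ge: "g (1, 0) = (1, 0)" using mult[of "(1, 0)" y] e by metis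
  have gc: "g (c, 0) = (c, 0)" for c
    using module_hom.scale[OF Vector_Spaces.linear.axioms(3)[OF lin], of c "(1, 0)"]
    by (simp add: P.scale_def ge)
  obtain c w where cw: "g (0, v) = (c, w)" by fastforce
  have "?m (0, v) (0, v) = (- \<beta> v v / 2, 0)"
    by (simp add: oct_mult_def c0 d0)
  then have "snd (?m (c, w) (c, w)) = 0"
    using mult[of "(0, v)" "(0, v)"] gc cw by (metis snd_conv)
  then have "scl c w + scl c w = 0"
    by (simp add: oct_mult_def c0 d0)
  then have "scl (2 * c) w = 0" by (simp add: scale_left_distrib[symmetric])
  then have "c = 0 \<or> w = 0" using two by simp
  moreover have "c = 0" if "w = 0"
  proof -
    have "g (0, v) = g (c, 0)" using cw gc that by simp
    then show ?thesis using bij by (simp add: bij_def inj_eq)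
  qed
  ultimately show ?thesis using cw by (auto simp: act_def)
qed

section \<open>\<open>\<gamma>\<close>-isotropic subspaces\<close>

definition gamma_vanishes :: "('v \<Rightarrow> 'v \<Rightarrow> 'v \<Rightarrow> 'k::zero) \<Rightarrow> 'v set \<Rightarrow> bool" where
  "gamma_vanishes \<gamma> W \<longleftrightarrow> (\<forall>u\<in>W. \<forall>v\<in>W. \<forall>w. \<gamma> u v w = 0)"

text \<open>
  For subspaces of dimension at least two this is the vanishing of \<open>\<gamma>(u,v,\<cdot>)\<close>, while a line is
  required to lie in such a plane (vanishing is automatic on lines).
\<close>
definition gamma_isotropic ::
    "('k::field \<Rightarrow> 'v::ab_group_add \<Rightarrow> 'v) \<Rightarrow> ('v \<Rightarrow> 'v \<Rightarrow> 'v \<Rightarrow> 'k) \<Rightarrow> 'v set \<Rightarrow> bool" where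
  "gamma_isotropic scl \<gamma> W \<longleftrightarrow>
     module.subspace scl W \<and>
     (vector_space.dim scl W \<ge> 2 \<and> gamma_vanishes \<gamma> W \<or>
      vector_space.dim scl W = 1 \<and>
        (\<exists>P. module.subspace scl P \<and> vector_space.dim scl P = 2 \<and>
             gamma_vanishes \<gamma> P \<and> W \<subseteq> P))"

definition E_space ::
    "('k::field \<Rightarrow> 'v::ab_group_add \<Rightarrow> 'v) \<Rightarrow> ('v \<Rightarrow> 'v \<Rightarrow> 'v \<Rightarrow> 'k) \<Rightarrow> 'v \<Rightarrow> 'v set" where
  "E_space scl \<gamma> u = {v. gamma_isotropic scl \<gamma> (module.span scl {u, v})}"

lemma E_space_eq:
  fixes scl :: "'k::field \<Rightarrow> 'v::ab_group_add \<Rightarrow> 'v"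
  assumes vs: "vector_space scl"
    and \<gamma>: "alternating_trilinear_form scl \<gamma>"
    and u: "u \<noteq> 0" "gamma_isotropic scl \<gamma> (module.span scl {u})"
  shows "E_space scl \<gamma> u = {v. \<forall>w. \<gamma> u v w = 0}"
proof -
  interpret vector_space scl by (rule vs)
  have l1: "Vector_Spaces.linear scl (*) (\<lambda>x. \<gamma> x v w)"
    and l2: "Vector_Spaces.linear scl (*) (\<lambda>x. \<gamma> v x w)"
    and alt: "\<gamma> v v w = 0" for v w
    using \<gamma> by (auto simp: alternating_trilinear_form_def)
  note add1 = module_hom.add[OF Vector_Spaces.linear.axioms(3)[OF l1]]
  note add2 = module_hom.add[OF Vector_Spaces.linear.axioms(3)[OF l2]]
  note sc1 = module_hom.scale[OF Vector_Spaces.linear.axioms(3)[OF l1]]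
  note sc2 = module_hom.scale[OF Vector_Spaces.linear.axioms(3)[OF l2]]
  have "gamma_isotropic scl \<gamma> (span {u, v}) \<longleftrightarrow> (\<forall>w. \<gamma> u v w = 0)" for v
  proof (cases "v \<in> span {u}")
    case True
    then have "span {u, v} = span {u}"
      by (metis insert_commute span_redundant)
    moreover obtain c where "v = scl c u" using True by (auto simp: span_singleton)
    ultimately show ?thesis using u(2) by (simp add: sc2 alt)
  next
    case False
    then have "u \<noteq> v" by (auto simp: span_base)
    have "independent {v, u}"
      using False u(1) by (intro independent_insertI independent_empty) auto
    then have "dim (span {u, v}) = 2"
      using \<open>u \<noteq> v\<close> dim_eq_card_independent[of "{v, u}"] dim_span[of "{u, v}"]
      by (simp add: insert_commute)
    then have "gamma_isotropic scl \<gamma> (span {u, v}) \<longleftrightarrow> gamma_vanishes \<gamma> (span {u, v})"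
      by (simp add: gamma_isotropic_def)
    also have "\<dots> \<longleftrightarrow> (\<forall>w. \<gamma> u v w = 0)"
    proof
      assume "gamma_vanishes \<gamma> (span {u, v})"
      then show "\<forall>w. \<gamma> u v w = 0" by (simp add: gamma_vanishes_def span_base)
    next
      assume 0: "\<forall>w. \<gamma> u v w = 0"
      have 1: "\<gamma> v u w = 0" for w
        using alt[of "u + v" w, unfolded add1 add2] 0 by (simp add: alt)
      show "gamma_vanishes \<gamma> (span {u, v})"
        unfolding gamma_vanishes_def
      proof (intro ballI allI)
        fix x y w assume "x \<in> span {u, v}" "y \<in> span {u, v}"
        then obtain a b c d where
          "x - scl a u = scl b v" "y - scl c u = scl d v"
          by (auto simp: span_insert span_singleton)
        then have "x = scl a u + scl b v" "y = scl c u + scl d v"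
          by (auto simp: algebra_simps)
        then show "\<gamma> x y w = 0" using 0 1 by (simp add: add1 add2 sc1 sc2 alt)
      qed
    qed
    finally show ?thesis .
  qed
  then show ?thesis by (simp add: E_space_def)
qed

section \<open>Splittings\<close>

definition splitting ::
    "('k::field \<Rightarrow> 'v::ab_group_add \<Rightarrow> 'v) \<Rightarrow> 'i set \<Rightarrow> ('i \<Rightarrow> 'v set) \<Rightarrow> bool" where
  "splitting scl I L \<longleftrightarrow>
     (\<forall>i\<in>I. module.subspace scl (L i)) \<and>
     (\<forall>v. \<exists>!x. x \<in> Pi\<^sub>E I L \<and> v = (\<Sum>i\<in>I. x i))"

section \<open>The tensor square of a vector space\<close>

text \<open>
  \<open>V \<otimes> V\<close> is the quotient of the free vector space on \<open>V \<times> V\<close>, i.e. the finitely supported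
  functions \<open>(V \<times> V) \<Rightarrow>\<^sub>0 k\<close>, by the span of the usual bilinearity relations. Its elements are
  cosets, added as sets; scalar multiplication adds the relation subspace back in, so that \<open>0\<close>
  times a coset is again a coset.
\<close>
definition free_scale :: "'k::field \<Rightarrow> ('x \<Rightarrow>\<^sub>0 'k) \<Rightarrow> ('x \<Rightarrow>\<^sub>0 'k)" where
  "free_scale c = Poly_Mapping.map ((*) c)"

definition free_extend ::
    "('k::field \<Rightarrow> 'w::ab_group_add \<Rightarrow> 'w) \<Rightarrow> ('x \<Rightarrow> 'w) \<Rightarrow> ('x \<Rightarrow>\<^sub>0 'k) \<Rightarrow> 'w" where
  "free_extend scl f p = (\<Sum>x\<in>Poly_Mapping.keys p. scl (Poly_Mapping.lookup p x) (f x))"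

definition formal :: "'v \<Rightarrow> 'v \<Rightarrow> ('v \<times> 'v \<Rightarrow>\<^sub>0 'k::field)" where
  "formal x y = Poly_Mapping.single (x, y) 1"

definition tensor_relations ::
    "('k::field \<Rightarrow> 'v::ab_group_add \<Rightarrow> 'v) \<Rightarrow> ('v \<times> 'v \<Rightarrow>\<^sub>0 'k) set" where
  "tensor_relations scl = module.span free_scale
     ({formal (x + x') y - formal x y - formal x' y | x x' y. True} \<union>
      {formal x (y + y') - formal x y - formal x y' | x y y'. True} \<union>
      {formal (scl c x) y - free_scale c (formal x y) | c x y. True} \<union>
      {formal x (scl c y) - free_scale c (formal x y) | c x y. True})"

definition tensor_class ::
    "('k::field \<Rightarrow> 'v::ab_group_add \<Rightarrow> 'v) \<Rightarrow> ('v \<times> 'v \<Rightarrow>\<^sub>0 'k) \<Rightarrow> ('v \<times> 'v \<Rightarrow>\<^sub>0 'k) set" where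
  "tensor_class scl p = {p} + tensor_relations scl"

definition tensor_space ::
    "('k::field \<Rightarrow> 'v::ab_group_add \<Rightarrow> 'v) \<Rightarrow> ('v \<times> 'v \<Rightarrow>\<^sub>0 'k) set set" where
  "tensor_space scl = range (tensor_class scl)"

definition tensor_scale ::
    "('k::field \<Rightarrow> 'v::ab_group_add \<Rightarrow> 'v) \<Rightarrow> 'k \<Rightarrow> ('v \<times> 'v \<Rightarrow>\<^sub>0 'k) set \<Rightarrow> ('v \<times> 'v \<Rightarrow>\<^sub>0 'k) set"
  where
  "tensor_scale scl c X = free_scale c ` X + tensor_relations scl"

text \<open>
  For subspaces \<open>A\<close> and \<open>B\<close> of \<open>V\<close>, the product \<open>A \<otimes> B\<close> as a subspace of \<open>V \<otimes> V\<close>: the span of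
  the \<open>a \<otimes> b\<close> with \<open>a \<in> A\<close> and \<open>b \<in> B\<close>. (Over a field, \<open>A \<otimes> B \<rightarrow> V \<otimes> V\<close> is injective.)
\<close>
definition subspace_tensor ::
    "('k::field \<Rightarrow> 'v::ab_group_add \<Rightarrow> 'v) \<Rightarrow> 'v set \<Rightarrow> 'v set \<Rightarrow> ('v \<times> 'v \<Rightarrow>\<^sub>0 'k) set set" where
  "subspace_tensor scl A B =
     tensor_class scl ` module.span free_scale {formal a b | a b. a \<in> A \<and> b \<in> B}"

text \<open>
  The linear map \<open>V \<otimes> V \<rightarrow> V\<close> with \<open>x \<otimes> y \<mapsto> b x y\<close>, for a bilinear \<open>b\<close>: the linear extension of
  \<open>b\<close> to the free vector space is constant on cosets (lemma \<open>tensor_lift_class\<close> below).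
\<close>
definition tensor_lift ::
    "('k::field \<Rightarrow> 'v::ab_group_add \<Rightarrow> 'v) \<Rightarrow> ('v \<Rightarrow> 'v \<Rightarrow> 'v) \<Rightarrow> ('v \<times> 'v \<Rightarrow>\<^sub>0 'k) set \<Rightarrow> 'v" where
  "tensor_lift scl b X = the_elem (free_extend scl (\<lambda>(x, y). b x y) ` X)"

text \<open>\<open>g \<otimes> g\<close> on \<open>V \<otimes> V\<close>, for a linear \<open>g\<close>; all members of the union coincide.\<close>
definition tensor_square ::
    "('k::field \<Rightarrow> 'v::ab_group_add \<Rightarrow> 'v) \<Rightarrow> ('v \<Rightarrow> 'v)
      \<Rightarrow> ('v \<times> 'v \<Rightarrow>\<^sub>0 'k) set \<Rightarrow> ('v \<times> 'v \<Rightarrow>\<^sub>0 'k) set" where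
  "tensor_square scl g X =
     (\<Union>p\<in>X. tensor_class scl (free_extend free_scale (\<lambda>(x, y). formal (g x) (g y)) p))"

text \<open>\<open>\<phi>\<close>, restricted to the subspace \<open>T\<close> of \<open>V \<otimes> V\<close>, is a linear isomorphism onto \<open>L \<subseteq> V\<close>.\<close>
definition tensor_iso ::
    "('k::field \<Rightarrow> 'v::ab_group_add \<Rightarrow> 'v) \<Rightarrow> (('v \<times> 'v \<Rightarrow>\<^sub>0 'k) set \<Rightarrow> 'v)
      \<Rightarrow> ('v \<times> 'v \<Rightarrow>\<^sub>0 'k) set set \<Rightarrow> 'v set \<Rightarrow> bool" where
  "tensor_iso scl \<phi> T L \<longleftrightarrow>
     bij_betw \<phi> T L \<and>
     (\<forall>X\<in>T. \<forall>Y\<in>T. \<phi> (X + Y) = \<phi> X + \<phi> Y) \<and>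
     (\<forall>c. \<forall>X\<in>T. \<phi> (tensor_scale scl c X) = scl c (\<phi> X))"

definition gamma_map ::
    "('k::field \<Rightarrow> 'v::ab_group_add \<Rightarrow> 'v) \<Rightarrow> ('v \<Rightarrow> 'v \<Rightarrow> 'k) \<Rightarrow> ('v \<Rightarrow> 'v \<Rightarrow> 'v \<Rightarrow> 'k)
      \<Rightarrow> ('v \<times> 'v \<Rightarrow>\<^sub>0 'k) set \<Rightarrow> 'v" where
  "gamma_map scl \<beta> \<gamma> = tensor_lift scl (\<lambda>v w. dagger \<beta> (\<lambda>x. \<gamma> v w x))"

lemma lookup_free_scale: "Poly_Mapping.lookup (free_scale c p) x = c * Poly_Mapping.lookup p x"
  by (simp add: free_scale_def Poly_Mapping.map.rep_eq when_def)

lemma vector_space_free_scale: "vector_space (free_scale :: 'k::field \<Rightarrow> ('x \<Rightarrow>\<^sub>0 'k) \<Rightarrow> _)"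
  by unfold_locales (auto intro!: poly_mapping_eqI simp: lookup_free_scale lookup_add algebra_simps)

interpretation free: vector_space "free_scale :: 'k::field \<Rightarrow> ('x \<Rightarrow>\<^sub>0 'k) \<Rightarrow> _"
  by (rule vector_space_free_scale)

lemma free_extend_superset:
  fixes scl :: "'k::field \<Rightarrow> 'v::ab_group_add \<Rightarrow> 'v"
  assumes "vector_space scl" "finite A" "Poly_Mapping.keys p \<subseteq> A"
  shows "free_extend scl f p = (\<Sum>x\<in>A. scl (Poly_Mapping.lookup p x) (f x))"
proof -
  interpret vector_space scl by fact
  show ?thesis unfolding free_extend_def
    by (rule sum.mono_neutral_left) (use assms in \<open>auto simp: in_keys_iff\<close>)
qed

lemma linear_free_extend:
  fixes scl :: "'k::field \<Rightarrow> 'v::ab_group_add \<Rightarrow> 'v"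
  assumes vs: "vector_space scl"
  shows "Vector_Spaces.linear free_scale scl (free_extend scl f)"
proof -
  interpret vector_space scl by fact
  have "free_extend scl f (p + q) = free_extend scl f p + free_extend scl f q" for p q
  proof -
    let ?A = "Poly_Mapping.keys p \<union> Poly_Mapping.keys q"
    show ?thesis
      using Poly_Mapping.keys_add[of p q]
      by (simp add: free_extend_superset[OF vs, of ?A] lookup_add scale_left_distrib sum.distrib)
  qed
  moreover have "free_extend scl f (free_scale c p) = scl c (free_extend scl f p)" for c p
  proof -
    have "Poly_Mapping.keys (free_scale c p) \<subseteq> Poly_Mapping.keys p"
      by (auto simp: in_keys_iff lookup_free_scale)
    then show ?thesis
      by (simp add: free_extend_superset[OF vs, of "Poly_Mapping.keys p"] lookup_free_scale
          scale_sum_right)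
  qed
  ultimately show ?thesis
    by (intro Vector_Spaces.linear.intro vector_space_free_scale vs module_hom.intro
        module_hom_axioms.intro) (auto intro: module_axioms free.module_axioms)
qed

lemma free_extend_formal:
  fixes scl :: "'k::field \<Rightarrow> 'v::ab_group_add \<Rightarrow> 'v"
  assumes "vector_space scl"
  shows "free_extend scl f (formal x y) = f (x, y)"
proof -
  interpret vector_space scl by fact
  show ?thesis by (simp add: free_extend_def formal_def)
qed

lemma free_extend_tensor_relations:
  fixes scl :: "'k::field \<Rightarrow> 'v::ab_group_add \<Rightarrow> 'v"
  assumes vs: "vector_space scl"
    and b: "\<And>y. Vector_Spaces.linear scl scl (\<lambda>x. b x y)"
           "\<And>x. Vector_Spaces.linear scl scl (\<lambda>y. b x y)"
    and r: "r \<in> tensor_relations scl"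
  shows "free_extend scl (\<lambda>(x, y). b x y) r = 0"
proof -
  interpret F: Vector_Spaces.linear free_scale scl "free_extend scl (\<lambda>(x, y). b x y)"
    by (rule linear_free_extend[OF vs])
  note m1 = Vector_Spaces.linear.axioms(3)[OF b(1)] and m2 = Vector_Spaces.linear.axioms(3)[OF b(2)]
  show ?thesis
    by (rule F.eq_0_on_span[OF _ r[unfolded tensor_relations_def]])
      (auto simp: F.diff F.scale free_extend_formal[OF vs] module_hom.add[OF m1]
        module_hom.add[OF m2] module_hom.scale[OF m1] module_hom.scale[OF m2])
qed

lemma tensor_lift_class:
  fixes scl :: "'k::field \<Rightarrow> 'v::ab_group_add \<Rightarrow> 'v"
  assumes vs: "vector_space scl"
    and b: "\<And>y. Vector_Spaces.linear scl scl (\<lambda>x. b x y)"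
           "\<And>x. Vector_Spaces.linear scl scl (\<lambda>y. b x y)"
  shows "tensor_lift scl b (tensor_class scl p) = free_extend scl (\<lambda>(x, y). b x y) p"
proof -
  interpret F: Vector_Spaces.linear free_scale scl "free_extend scl (\<lambda>(x, y). b x y)"
    by (rule linear_free_extend[OF vs])
  have "0 \<in> tensor_relations scl" by (simp add: tensor_relations_def free.span_zero)
  then have "free_extend scl (\<lambda>(x, y). b x y) ` tensor_class scl p =
      {free_extend scl (\<lambda>(x, y). b x y) p}"
    by (force simp: tensor_class_def set_plus_def F.add free_extend_tensor_relations[OF vs b])
  then show ?thesis by (simp add: tensor_lift_def)
qed

lemma tensor_class_add:
  fixes scl :: "'k::field \<Rightarrow> 'v::ab_group_add \<Rightarrow> 'v"
  shows "tensor_class scl p + tensor_class scl q = tensor_class scl (p + q)"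
proof -
  let ?N = "tensor_relations scl"
  have add: "x + y \<in> ?N" if "x \<in> ?N" "y \<in> ?N" for x y
    using that by (simp add: tensor_relations_def free.span_add)
  have zero: "0 \<in> ?N" by (simp add: tensor_relations_def free.span_zero)
  show ?thesis
  proof (intro equalityI subsetI)
    fix x assume "x \<in> tensor_class scl p + tensor_class scl q"
    then obtain r s where "r \<in> ?N" "s \<in> ?N" "x = (p + r) + (q + s)"
      by (auto simp: tensor_class_def set_plus_def)
    then have "r + s \<in> ?N" "x = (p + q) + (r + s)" by (simp_all add: add algebra_simps)
    then show "x \<in> tensor_class scl (p + q)" by (auto simp: tensor_class_def set_plus_def)
  next
    fix x assume "x \<in> tensor_class scl (p + q)"
    then obtain r where "r \<in> ?N" "x = (p + r) + (q + 0)"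
      by (auto simp: tensor_class_def set_plus_def algebra_simps)
    with zero show "x \<in> tensor_class scl p + tensor_class scl q"
      unfolding tensor_class_def set_plus_def by blast
  qed
qed

lemma tensor_class_scale:
  fixes scl :: "'k::field \<Rightarrow> 'v::ab_group_add \<Rightarrow> 'v"
  shows "tensor_scale scl c (tensor_class scl p) = tensor_class scl (free_scale c p)"
proof (intro equalityI subsetI)
  fix x assume "x \<in> tensor_scale scl c (tensor_class scl p)"
  then obtain r s where "x = free_scale c (p + r) + s"
      and "r \<in> tensor_relations scl" "s \<in> tensor_relations scl"
    by (auto simp: tensor_scale_def tensor_class_def set_plus_def)
  then have "x = free_scale c p + (free_scale c r + s)"
      and "free_scale c r + s \<in> tensor_relations scl"
    by (auto simp: free.scale_right_distrib add.assoc tensor_relations_def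
        intro: free.span_add free.span_scale)
  then show "x \<in> tensor_class scl (free_scale c p)"
    by (auto simp: tensor_class_def set_plus_def)
next
  fix x assume "x \<in> tensor_class scl (free_scale c p)"
  then obtain s where "x = free_scale c (p + 0) + s" "s \<in> tensor_relations scl"
    by (auto simp: tensor_class_def set_plus_def)
  moreover have "0 \<in> tensor_relations scl" by (simp add: tensor_relations_def free.span_zero)
  ultimately show "x \<in> tensor_scale scl c (tensor_class scl p)"
    unfolding tensor_scale_def tensor_class_def set_plus_def by blast
qed

end

theory Submission
  imports Defs
begin

text \<open>
  Write \<open>x \<times> y\<close> for \<open>\<gamma>(x, y, \<cdot>)\<^sup>\<dagger>\<close> (the constant \<open>cross\<close> below). Let \<open>u\<close>, \<open>v\<close>, \<open>w\<close> generate
  \<open>L 1\<close>, \<open>L 2\<close>, \<open>L 3\<close>. Since \<open>L 2 \<otimes> L 3\<close> is the line through \<open>v \<otimes> w\<close>, the isomorphism onto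
  \<open>L 1\<close> amounts to \<open>v \<times> w\<close> being a nonzero multiple of \<open>u\<close> (\<open>tensor_iso_lines\<close>,
  \<open>annihilator_cross\<close>).

  Compatibility says that \<open>2 x \<times> (x \<times> z) = \<beta>(x, z) x - \<beta>(x, x) z\<close> (\<open>cross_cross\<close>). It follows that
  \<open>E\<^sub>u = {x. u \<times> x = 0}\<close>, which is the span of \<open>u\<close>, \<open>v\<close>, \<open>w\<close>, is totally isotropic for \<open>\<beta>\<close>. The
  polarized identity then gives \<open>u \<times> (v \<times> w) = 0\<close>, so \<open>v \<times> w = a u + b v + c w\<close>. Since
  \<open>v \<times> (v \<times> w) = 0 = w \<times> (v \<times> w)\<close>, both \<open>b\<close> and \<open>c\<close> annihilate \<open>v \<times> w\<close>. Hence \<open>v \<times> w\<close> is a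
  multiple of \<open>u\<close> as soon as it is not \<open>0\<close>.

  If it were \<open>0\<close>, all products within \<open>E\<^sub>u\<close> would vanish. For a suitable \<open>v'\<close> in \<open>E\<^sub>u\<close> and \<open>z\<close>
  outside the orthogonal complement of \<open>u\<close>, the vector \<open>v' \<times> z\<close> would then extend \<open>E\<^sub>u\<close> to a
  4-dimensional totally isotropic space (\<open>isotropic_triple_dim\<close>), which is impossible in
  dimension 7 (\<open>totally_isotropic_card\<close>).

  Equivariance holds because an automorphism of \<open>C\<close> fixes the identity and preserves \<open>V\<close>, so that
  comparing the \<open>V\<close>-components of a product shows that it preserves \<open>\<times>\<close> (\<open>act_cross\<close>). The
  lines \<open>g L 1\<close>, \<open>g L 2\<close>, \<open>g L 3\<close> are generated by \<open>g v \<times> g w = g (v \<times> w)\<close>, \<open>g v\<close> and \<open>g w\<close>, so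
  \<open>tensor_iso_lines\<close> applies to them as well.
\<close>

section \<open>Tensor products\<close>

lemma tensor_class_eqI:
  assumes "p - q \<in> tensor_relations scl"
  shows "tensor_class scl p = tensor_class scl q"
proof -
  let ?N = "tensor_relations scl"
  have sub: "tensor_class scl p \<subseteq> tensor_class scl q" if "p - q \<in> ?N" for p q
  proof
    fix x assume "x \<in> tensor_class scl p"
    then obtain r where "r \<in> ?N" "x = p + r" by (auto simp: tensor_class_def set_plus_def)
    then have "x = q + ((p - q) + r)" "(p - q) + r \<in> ?N"
      using that by (auto simp: tensor_relations_def free.span_add)
    then show "x \<in> tensor_class scl q" unfolding tensor_class_def set_plus_def by blast
  qed
  have "q - p \<in> ?N"
    using assms free.span_neg[of "p - q"] by (simp add: tensor_relations_def)
  with assms show ?thesis by (simp add: sub subset_antisym)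
qed

lemma linear_free_extend_comp:
  assumes "Vector_Spaces.linear s1 s2 h"
  shows "h (free_extend s1 f p) = free_extend s2 (\<lambda>x. h (f x)) p"
proof -
  interpret h: Vector_Spaces.linear s1 s2 h by fact
  show ?thesis by (simp add: free_extend_def h.sum h.scale)
qed

text \<open>
  A linear map sends each of the four families of relations into itself, so all members of the
  union that defines \<open>tensor_square\<close> are one coset.
\<close>
lemma tensor_square_class:
  assumes g: "Vector_Spaces.linear scl scl g"
  shows "tensor_square scl g (tensor_class scl p) =
    tensor_class scl (free_extend free_scale (\<lambda>(x, y). formal (g x) (g y)) p)"
proof -
  interpret g: Vector_Spaces.linear scl scl g by fact
  let ?F = "free_extend free_scale (\<lambda>(x, y). formal (g x) (g y)) :: ('b \<times> 'b \<Rightarrow>\<^sub>0 'a) \<Rightarrow> _"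
  let ?N = "tensor_relations scl"
  interpret F: Vector_Spaces.linear free_scale free_scale ?F
    by (rule linear_free_extend[OF vector_space_free_scale])
  have Ff: "?F (formal x y) = formal (g x) (g y)" for x y
    by (simp add: free_extend_formal[OF vector_space_free_scale])
  have "?F ` ?N \<subseteq> ?N"
    unfolding tensor_relations_def F.span_image[symmetric]
  proof (rule free.span_mono)
    show "?F ` ({formal (x + x') y - formal x y - formal x' y | x x' y. True} \<union>
      {formal x (y + y') - formal x y - formal x y' | x y y'. True} \<union>
      {formal (scl c x) y - free_scale c (formal x y) | c x y. True} \<union>
      {formal x (scl c y) - free_scale c (formal x y) | c x y. True}) \<subseteq>
      {formal (x + x') y - formal x y - formal x' y | x x' y. True} \<union>
      {formal x (y + y') - formal x y - formal x y' | x y y'. True} \<union>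
      {formal (scl c x) y - free_scale c (formal x y) | c x y. True} \<union>
      {formal x (scl c y) - free_scale c (formal x y) | c x y. True}"
      by (rule image_subsetI, elim UnE) (auto simp: F.diff F.scale Ff g.add g.scale, blast+)
  qed
  then have "tensor_class scl (?F q) = tensor_class scl (?F p)" if "q \<in> tensor_class scl p" for q
    using that by (intro tensor_class_eqI) (auto simp: tensor_class_def set_plus_def F.add)
  moreover have "p \<in> tensor_class scl p"
    using free.span_zero by (force simp: tensor_class_def set_plus_def tensor_relations_def)
  ultimately show ?thesis unfolding tensor_square_def by (intro SUP_eq_const) blast+
qed

lemma tensor_square_line:
  assumes g: "Vector_Spaces.linear scl scl g"
  shows "tensor_square scl g (tensor_class scl (free_scale c (formal v w))) =
    tensor_class scl (free_scale c (formal (g v) (g w)))"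
proof -
  interpret F: Vector_Spaces.linear free_scale free_scale
    "free_extend free_scale (\<lambda>(x, y). formal (g x) (g y)) :: ('b \<times> 'b \<Rightarrow>\<^sub>0 'a) \<Rightarrow> _"
    by (rule linear_free_extend[OF vector_space_free_scale])
  show ?thesis
    by (simp add: tensor_square_class[OF g] F.scale free_extend_formal[OF vector_space_free_scale])
qed

text \<open>
  Each generator \<open>(a v) \<otimes> (b w)\<close> is the multiple \<open>a b\<close> of \<open>v \<otimes> w\<close>, by one scaling relation in
  each factor.
\<close>
lemma subspace_tensor_lines:
  assumes vs: "vector_space scl"
  shows "subspace_tensor scl (module.span scl {v}) (module.span scl {w}) =
    range (\<lambda>c. tensor_class scl (free_scale c (formal v w)))"
proof -
  interpret vector_space scl by fact
  let ?f = "formal v w" and ?N = "tensor_relations scl"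
  let ?G = "{formal a b | a b. a \<in> span {v} \<and> b \<in> span {w}}"
  have N_sub: "free.subspace ?N" by (simp add: tensor_relations_def)
  have gen: "formal (scl a v) (scl b w) - free_scale (a * b) ?f \<in> ?N" for a b
  proof -
    have "formal (scl a v) (scl b w) - free_scale a (formal v (scl b w)) \<in> ?N"
      unfolding tensor_relations_def by (rule free.span_base) blast
    moreover have "formal v (scl b w) - free_scale b ?f \<in> ?N"
      unfolding tensor_relations_def by (rule free.span_base) blast
    ultimately have "(formal (scl a v) (scl b w) - free_scale a (formal v (scl b w)))
        + free_scale a (formal v (scl b w) - free_scale b ?f) \<in> ?N"
      by (intro free.subspace_add[OF N_sub] free.subspace_scale[OF N_sub])
    then show ?thesis by (simp add: free.scale_right_diff_distrib)
  qed
  have "\<exists>c. p - free_scale c ?f \<in> ?N" if "p \<in> free.span ?G" for p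
    using that
  proof (induction rule: free.span_induct_alt)
    case base
    show ?case by (rule exI[of _ 0]) (simp add: free.subspace_0[OF N_sub])
  next
    case (step c x y)
    then obtain a b d where x: "x = formal (scl a v) (scl b w)" and d: "y - free_scale d ?f \<in> ?N"
      by (auto simp: span_singleton)
    have "free_scale c (x - free_scale (a * b) ?f) + (y - free_scale d ?f) \<in> ?N"
      using gen[of a b] d x
      by (intro free.subspace_add[OF N_sub] free.subspace_scale[OF N_sub]) auto
    also have "free_scale c (x - free_scale (a * b) ?f) + (y - free_scale d ?f)
        = (free_scale c x + y) - free_scale (c * (a * b) + d) ?f"
      by (simp add: free.scale_right_diff_distrib free.scale_left_distrib algebra_simps)
    finally show ?case by blast
  qed
  then have "tensor_class scl p \<in> range (\<lambda>c. tensor_class scl (free_scale c ?f))"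
    if "p \<in> free.span ?G" for p
    using that tensor_class_eqI by blast
  moreover have "free_scale c ?f \<in> free.span ?G" for c
    by (rule free.span_scale, rule free.span_base) (use span_base in blast)
  ultimately show ?thesis by (auto simp: subspace_tensor_def)
qed

lemma tensor_lift_linear:
  assumes vs: "vector_space scl"
    and b: "\<And>y. Vector_Spaces.linear scl scl (\<lambda>x. b x y)"
           "\<And>x. Vector_Spaces.linear scl scl (\<lambda>y. b x y)"
    and X: "X \<in> tensor_space scl" and Y: "Y \<in> tensor_space scl"
  shows "tensor_lift scl b (X + Y) = tensor_lift scl b X + tensor_lift scl b Y"
    and "tensor_lift scl b (tensor_scale scl c X) = scl c (tensor_lift scl b X)"
proof -
  interpret F: Vector_Spaces.linear free_scale scl "free_extend scl (\<lambda>(x, y). b x y)"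
    by (rule linear_free_extend[OF vs])
  obtain p q where "X = tensor_class scl p" "Y = tensor_class scl q"
    using X Y by (auto simp: tensor_space_def)
  note [simp] = this tensor_class_add tensor_class_scale tensor_lift_class[OF vs b] F.add F.scale
  show "tensor_lift scl b (X + Y) = tensor_lift scl b X + tensor_lift scl b Y"
    and "tensor_lift scl b (tensor_scale scl c X) = scl c (tensor_lift scl b X)"
    by simp_all
qed

text \<open>
  The tensor product of two lines consists of the multiples of the single class \<open>v \<otimes> w\<close>. The map
  takes \<open>c (v \<otimes> w)\<close> to \<open>c (b v w)\<close>, and these vectors are distinct for distinct \<open>c\<close>.
\<close>
lemma tensor_iso_lines:
  assumes vs: "vector_space scl"
    and b: "\<And>y. Vector_Spaces.linear scl scl (\<lambda>x. b x y)"
           "\<And>x. Vector_Spaces.linear scl scl (\<lambda>y. b x y)"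
    and nz: "b v w \<noteq> 0"
  shows "tensor_iso scl (tensor_lift scl b)
    (subspace_tensor scl (module.span scl {v}) (module.span scl {w})) (module.span scl {b v w})"
proof -
  interpret vector_space scl by fact
  interpret F: Vector_Spaces.linear free_scale scl "free_extend scl (\<lambda>(x, y). b x y)"
    by (rule linear_free_extend[OF vs])
  let ?T = "range (\<lambda>c. tensor_class scl (free_scale c (formal v w)))"
  have val: "tensor_lift scl b (tensor_class scl (free_scale c (formal v w))) = scl c (b v w)" for c
    by (simp add: tensor_lift_class[OF vs b] F.scale free_extend_formal[OF vs])
  have "inj_on (tensor_lift scl b) ?T"
    by (rule inj_onI) (use nz in \<open>auto simp: val scale_cancel_right\<close>)
  moreover have "tensor_lift scl b ` ?T = span {b v w}"
    by (simp add: image_image val span_singleton)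
  moreover have T: "X \<in> tensor_space scl" if "X \<in> ?T" for X
    using that by (auto simp: tensor_space_def)
  ultimately show ?thesis
    unfolding tensor_iso_def bij_betw_def subspace_tensor_lines[OF vs]
    by (intro conjI ballI allI tensor_lift_linear[OF vs b] T)
qed

text \<open>
  Lifted to the free vector space, both sides are linear, and on a generator \<open>(x, y)\<close> they are
  \<open>b (g x) (g y)\<close> and \<open>g (b x y)\<close>.
\<close>
lemma tensor_lift_equivariant:
  assumes vs: "vector_space scl"
    and b: "\<And>y. Vector_Spaces.linear scl scl (\<lambda>x. b x y)"
           "\<And>x. Vector_Spaces.linear scl scl (\<lambda>y. b x y)"
    and g: "Vector_Spaces.linear scl scl g"
    and hom: "\<And>x y. g (b x y) = b (g x) (g y)"
    and X: "X \<in> tensor_space scl"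
  shows "tensor_lift scl b (tensor_square scl g X) = g (tensor_lift scl b X)"
proof -
  obtain p where p: "X = tensor_class scl p" using X by (auto simp: tensor_space_def)
  have "free_extend scl (\<lambda>(x, y). b x y) (free_extend free_scale (\<lambda>(x, y). formal (g x) (g y)) p)
      = free_extend scl (\<lambda>z. g (case z of (x, y) \<Rightarrow> b x y)) p"
    unfolding linear_free_extend_comp[OF linear_free_extend[OF vs]]
    by (rule arg_cong[of _ _ "\<lambda>f. free_extend scl f p"])
      (auto simp: fun_eq_iff free_extend_formal[OF vs] hom)
  also have "\<dots> = g (free_extend scl (\<lambda>(x, y). b x y) p)"
    by (rule linear_free_extend_comp[OF g, symmetric])
  finally show ?thesis
    by (simp add: p tensor_square_class[OF g] tensor_lift_class[OF vs b])
qed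

section \<open>Lines and splittings\<close>

context vector_space
begin

lemma endomorphismI:
  assumes "\<And>x y. f (x + y) = f x + f y" "\<And>c x. f (scale c x) = scale c (f x)"
  shows "Vector_Spaces.linear scale scale f"
  by (intro Vector_Spaces.linear.intro module_hom.intro module_hom_axioms.intro
      vector_space_axioms module_axioms assms)

lemma line_eq_span:
  assumes "subspace S" "dim S = 1"
  shows "\<exists>l. l \<noteq> 0 \<and> S = span {l}"
proof -
  obtain B where B: "B \<subseteq> S" "independent B" "S \<subseteq> span B" "card B = dim S"
    using basis_exists by blast
  then obtain l where "B = {l}" using assms(2) by (auto simp: card_1_singleton_iff)
  with B assms(1) have "S = span {l}" by (metis span_minimal subset_antisym)
  moreover have "l \<noteq> 0" using B(2) \<open>B = {l}\<close> by auto
  ultimately show ?thesis by blast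
qed

lemma span_singleton_eqI:
  assumes "u \<in> span {l}" "u \<noteq> 0"
  shows "span {l} = span {u}"
proof -
  obtain c where "u = scale c l" "c \<noteq> 0" using assms by (auto simp: span_singleton)
  then have "l = scale (inverse c) u" by simp
  then have "l \<in> span {u}" by (metis span_base span_scale singletonI)
  then show ?thesis using assms(1) by (meson span_minimal subspace_span subset_antisym empty_subsetI insert_subset)
qed

lemma splitting_unique:
  assumes S: "splitting scale I L"
    and x: "\<And>i. i \<in> I \<Longrightarrow> x i \<in> L i" and sum: "(\<Sum>i\<in>I. x i) = 0" and i: "i \<in> I"
  shows "x i = 0"
proof -
  have sub: "subspace (L i)" if "i \<in> I" for i using S that by (simp add: splitting_def)
  have ex: "\<exists>!y. y \<in> Pi\<^sub>E I L \<and> 0 = (\<Sum>i\<in>I. y i)" using S unfolding splitting_def by blast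
  have "restrict x I \<in> Pi\<^sub>E I L \<and> 0 = (\<Sum>i\<in>I. restrict x I i)"
    and "restrict (\<lambda>_. 0) I \<in> Pi\<^sub>E I L \<and> 0 = (\<Sum>i\<in>I. restrict (\<lambda>_. 0) I i)"
    using x sum subspace_0[OF sub] by auto
  then have "restrict x I = restrict (\<lambda>_. 0) I" using ex by blast
  then show ?thesis using i by (metis restrict_apply)
qed

text \<open>
  A family \<open>i \<mapsto> c i l i\<close> with sum \<open>0\<close> must be the zero family. The coefficients are indexed by
  \<open>I\<close> rather than by vectors, so this also rules out repetitions among the \<open>l i\<close>: the coefficients
  \<open>1\<close> at \<open>i\<close> and \<open>-1\<close> at \<open>j\<close> would give a vanishing sum.
\<close>
lemma splitting_independent:
  assumes S: "splitting scale I L" and fin: "finite I"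
    and l: "\<And>i. i \<in> I \<Longrightarrow> l i \<in> L i" "\<And>i. i \<in> I \<Longrightarrow> l i \<noteq> 0"
  shows "independent (l ` I)" and "inj_on l I"
proof -
  have sub: "subspace (L i)" if "i \<in> I" for i using S that by (simp add: splitting_def)
  have coeff: "c i = 0" if "(\<Sum>i\<in>I. scale (c i) (l i)) = 0" "i \<in> I" for c i
    using splitting_unique[OF S _ that] sub l subspace_scale that(2) by (metis scale_eq_0_iff)
  show inj: "inj_on l I"
  proof (rule inj_onI, rule ccontr)
    fix i j assume ij: "i \<in> I" "j \<in> I" "l i = l j" "i \<noteq> j"
    let ?c = "\<lambda>n. (if n = i then 1 else 0) - (if n = j then 1 else 0)"
    have "(\<Sum>n\<in>I. scale (?c n) (l n)) = (\<Sum>n\<in>I. if n = i then l n else 0) - (\<Sum>n\<in>I. if n = j then l n else 0)"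
      unfolding sum_subtractf[symmetric] by (rule sum.cong) (auto simp: scale_left_diff_distrib)
    also have "\<dots> = 0" using ij fin by simp
    finally have "?c i = (0::'a)" using ij(1) by (rule coeff)
    with ij(4) show False by simp
  qed
  show "independent (l ` I)"
  proof (rule independent_if_scalars_zero)
    fix f x assume "(\<Sum>x\<in>l ` I. scale (f x) x) = 0" "x \<in> l ` I"
    then show "f x = 0" using coeff[of "f \<circ> l"] by (auto simp: sum.reindex[OF inj])
  qed (use fin in simp)
qed

end

section \<open>Symmetric bilinear forms\<close>

locale nondegenerate_form = vector_space scl
  for scl :: "'k::field \<Rightarrow> 'v::ab_group_add \<Rightarrow> 'v" +
  fixes \<beta> :: "'v \<Rightarrow> 'v \<Rightarrow> 'k"
  assumes fin_dim: "\<exists>B. finite B \<and> span B = UNIV"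
    and \<beta>: "symmetric_bilinear_form scl \<beta>" "nondegenerate \<beta>"
begin

lemma \<beta>_linear: "Vector_Spaces.linear scl (*) (\<lambda>x. \<beta> x y)" "Vector_Spaces.linear scl (*) (\<lambda>y. \<beta> x y)"
  using \<beta>(1) by (simp_all add: symmetric_bilinear_form_def)

lemmas \<beta>_hom = \<beta>_linear[THEN Vector_Spaces.linear.axioms(3)]

lemmas \<beta>_simps =
  \<beta>_hom(1)[THEN module_hom.add] \<beta>_hom(2)[THEN module_hom.add]
  \<beta>_hom(1)[THEN module_hom.diff] \<beta>_hom(2)[THEN module_hom.diff]
  \<beta>_hom(1)[THEN module_hom.scale] \<beta>_hom(2)[THEN module_hom.scale]
  \<beta>_hom(1)[THEN module_hom.neg]
  \<beta>_hom(1)[THEN module_hom.zero] \<beta>_hom(2)[THEN module_hom.zero]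

lemma \<beta>_commute: "\<beta> x y = \<beta> y x"
  using \<beta>(1) by (simp add: symmetric_bilinear_form_def)

lemma \<beta>_eqI:
  assumes "\<And>w. \<beta> x w = \<beta> y w"
  shows "x = y"
proof -
  have "\<beta> (x - y) w = 0" for w using assms by (simp add: \<beta>_simps)
  then show ?thesis using \<beta>(2) unfolding nondegenerate_def by (metis eq_iff_diff_eq_0)
qed

lemma \<beta>_eq_0_on_span:
  assumes "\<And>b. b \<in> B \<Longrightarrow> \<beta> x b = 0" "y \<in> span B"
  shows "\<beta> x y = 0"
  by (rule module_hom.eq_0_on_span[OF \<beta>_hom(2) assms])

lemma coordinate_map_linear:
  "Vector_Spaces.linear scl scl (\<lambda>y. \<Sum>b\<in>B. scl (\<beta> y b) b)"
  by (rule endomorphismI) (simp_all add: \<beta>_simps scale_left_distrib sum.distrib scale_sum_right)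

lemma coordinate_map_eq_0:
  assumes "finite B" "independent B" "(\<Sum>b\<in>B. scl (\<beta> y b) b) = 0" "b \<in> B"
  shows "\<beta> y b = 0"
  by (rule independentD[OF assms(2,1) order_refl assms(3,4)])

text \<open>
  In coordinates for a basis \<open>B\<close>, \<open>y \<mapsto> \<beta>(y, \<cdot>)\<close> is the endomorphism \<open>y \<mapsto> \<Sum>b\<in>B. \<beta>(y, b) b\<close>. It is
  injective by nondegeneracy, hence surjective.
\<close>
lemma \<beta>_represents:
  assumes f: "Vector_Spaces.linear scl (*) f"
  shows "\<exists>y. \<beta> y = f"
proof -
  obtain B where B: "independent B" "span B = UNIV" "finite B"
    by (metis fin_dim basis_exists finite_subset independent_span_bound maximal_independent_subset
        span_UNIV top.extremum_uniqueI subset_UNIV)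
  interpret fd: finite_dimensional_vector_space scl B
    using B by unfold_locales auto
  let ?T = "\<lambda>y. \<Sum>b\<in>B. scl (\<beta> y b) b"
  interpret T: Vector_Spaces.linear scl scl ?T by (rule coordinate_map_linear)
  have "inj ?T"
    unfolding T.inj_iff_eq_0
  proof (intro allI impI)
    fix y assume "?T y = 0"
    then have "\<beta> y w = 0" for w
      using \<beta>_eq_0_on_span[of B y w] coordinate_map_eq_0[OF B(3,1)] B(2) by auto
    then show "y = 0" by (intro \<beta>_eqI) (simp add: \<beta>_simps)
  qed
  then have "surj ?T" using fd.linear_inj_imp_surj coordinate_map_linear by blast
  then obtain y where y: "(\<Sum>b\<in>B. scl (f b) b) = ?T y" by (rule surjE)
  then have "(\<Sum>b\<in>B. scl (\<beta> y b - f b) b) = 0"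
    by (simp add: scale_left_diff_distrib sum_subtractf)
  then have eq: "\<beta> y b = f b" if "b \<in> B" for b
    using independentD[OF B(1,3) order_refl] that by (metis eq_iff_diff_eq_0)
  interpret p: vector_space_pair scl "(*)" using f by (simp add: Vector_Spaces.linear_def vector_space_pair_def)
  have "\<beta> y w = f w" for w
    by (rule p.linear_eq_on[OF \<beta>_linear(2) f, of w B]) (use B eq in auto)
  then show ?thesis by auto
qed

lemma \<beta>_dagger: "Vector_Spaces.linear scl (*) f \<Longrightarrow> \<beta> (dagger \<beta> f) = f"
  unfolding dagger_def by (metis \<beta>_represents f_inv_into_f rangeI)

text \<open>
  Complete \<open>S\<close> to a basis \<open>S \<union> C\<close>. A vector of \<open>span S\<close> is orthogonal to \<open>S\<close> already, so it is
  determined by its products with \<open>C\<close>; this embeds \<open>span S\<close> into \<open>span C\<close>.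
\<close>
lemma totally_isotropic_card:
  assumes S: "independent S" and iso: "\<And>x y. x \<in> S \<Longrightarrow> y \<in> S \<Longrightarrow> \<beta> x y = 0"
  shows "2 * card S \<le> dim (UNIV :: 'v set)"
proof -
  obtain B where B: "S \<subseteq> B" "independent B" "span B = UNIV"
    using maximal_independent_subset_extend[OF subset_UNIV S] by (metis top.extremum_uniqueI)
  have fin: "finite B"
    using fin_dim independent_span_bound B(2) by auto
  define C where "C = B - S"
  have C: "finite C" "independent C"
    using fin B(2) independent_mono by (auto simp: C_def)
  let ?T = "\<lambda>y. \<Sum>c\<in>C. scl (\<beta> y c) c"
  interpret T: Vector_Spaces.linear scl scl ?T by (rule coordinate_map_linear)
  interpret vector_space_pair scl scl ..
  have inj: "inj_on ?T (span S)"
    unfolding T.inj_on_iff_eq_0[OF subspace_span]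
  proof (intro ballI impI)
    fix y assume y: "y \<in> span S" "?T y = 0"
    have "\<beta> y b = 0" if "b \<in> B" for b
    proof (cases "b \<in> S")
      case True
      have "\<beta> b y = 0" by (rule \<beta>_eq_0_on_span[OF _ y(1)]) (use iso True in auto)
      then show ?thesis by (simp add: \<beta>_commute)
    next
      case False
      then show ?thesis using that coordinate_map_eq_0[OF C y(2)] by (simp add: C_def)
    qed
    then have "\<beta> y w = 0" for w
      using \<beta>_eq_0_on_span[of B y w] B(3) by auto
    then show "y = 0" by (intro \<beta>_eqI) (simp add: \<beta>_simps)
  qed
  have "independent (?T ` S)"
    by (rule linear_independent_injective_image[OF coordinate_map_linear S inj])
  moreover have "?T ` S \<subseteq> span C"
    by (intro image_subsetI span_sum span_scale) (rule span_base)
  ultimately have "card (?T ` S) \<le> card C"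
    using independent_span_bound[OF C(1)] by blast
  moreover have "card (?T ` S) = card S"
    by (rule card_image) (use inj span_superset inj_on_subset in blast)
  moreover have "card C = card B - card S" "card S \<le> card B"
    using fin B(1) by (simp_all add: C_def card_Diff_subset finite_subset card_mono)
  moreover have "dim (UNIV :: 'v set) = card B"
    using dim_eq_card[of B UNIV] B by simp
  ultimately show ?thesis by simp
qed

end

section \<open>The cross product of a compatible pair\<close>

locale compatible_forms = nondegenerate_form scl \<beta>
  for scl :: "'k::field \<Rightarrow> 'v::ab_group_add \<Rightarrow> 'v" and \<beta> +
  fixes \<gamma> :: "'v \<Rightarrow> 'v \<Rightarrow> 'v \<Rightarrow> 'k"
  assumes char: "CHAR('k) \<noteq> 2"
    and \<gamma>: "alternating_trilinear_form scl \<gamma>"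
    and compat: "compatible \<beta> \<gamma>"
begin

lemma two: "(2::'k) \<noteq> 0"
proof
  assume "(2::'k) = 0"
  then have "of_nat 2 = (0::'k)" by simp
  then have "CHAR('k) dvd 2" by (simp only: of_nat_eq_0_iff_char_dvd)
  then have "CHAR('k) = 1 \<or> CHAR('k) = 2"
    using prime_nat_iff two_is_prime_nat by blast
  with char show False by simp
qed

lemma scale_double: "scl (2 * c) x = scl c x + scl c x"
  by (metis mult_2 scale_left_distrib)

lemma scale_two_eq_0: "scl 2 x = 0 \<Longrightarrow> x = 0"
  using two by simp

definition cross :: "'v \<Rightarrow> 'v \<Rightarrow> 'v" where
  "cross x y = dagger \<beta> (\<lambda>w. \<gamma> x y w)"

lemma \<gamma>_linear:
  "Vector_Spaces.linear scl (*) (\<lambda>x. \<gamma> x y z)"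
  "Vector_Spaces.linear scl (*) (\<lambda>y. \<gamma> x y z)"
  "Vector_Spaces.linear scl (*) (\<lambda>z. \<gamma> x y z)"
  using \<gamma> unfolding alternating_trilinear_form_def by blast+

lemmas \<gamma>_hom = \<gamma>_linear[THEN Vector_Spaces.linear.axioms(3)]

lemmas \<gamma>_simps =
  \<gamma>_hom(1)[THEN module_hom.add] \<gamma>_hom(2)[THEN module_hom.add]
  \<gamma>_hom(1)[THEN module_hom.scale] \<gamma>_hom(2)[THEN module_hom.scale]

lemma \<gamma>_alternating: "\<gamma> x x y = 0" "\<gamma> x y x = 0" "\<gamma> y x x = 0"
  using \<gamma> unfolding alternating_trilinear_form_def by blast+

lemma \<gamma>_swap12: "\<gamma> y x z = - \<gamma> x y z"
proof -
  have "\<gamma> x y z + \<gamma> y x z = 0"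
    using \<gamma>_alternating(1)[of "y + x" z] unfolding \<gamma>_simps by (simp add: \<gamma>_alternating)
  then show ?thesis by (rule minus_unique[symmetric])
qed

lemma \<gamma>_swap23: "\<gamma> x z y = - \<gamma> x y z"
proof -
  have "\<gamma> x y z + \<gamma> x z y = 0"
    using \<gamma>_alternating(3)[of x "z + y"]
    unfolding \<gamma>_simps \<gamma>_hom(3)[THEN module_hom.add] by (simp add: \<gamma>_alternating)
  then show ?thesis by (rule minus_unique[symmetric])
qed

lemma \<beta>_cross: "\<beta> (cross x y) z = \<gamma> x y z"
  using \<beta>_dagger[OF \<gamma>_linear(3)] by (simp add: cross_def)

lemma cross_linear:
  "Vector_Spaces.linear scl scl (\<lambda>x. cross x y)" "Vector_Spaces.linear scl scl (\<lambda>y. cross x y)"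
proof -
  show "Vector_Spaces.linear scl scl (\<lambda>x. cross x y)"
    by (rule endomorphismI; rule \<beta>_eqI) (simp_all add: \<beta>_simps \<beta>_cross \<gamma>_simps)
  show "Vector_Spaces.linear scl scl (\<lambda>y. cross x y)"
    by (rule endomorphismI; rule \<beta>_eqI) (simp_all add: \<beta>_simps \<beta>_cross \<gamma>_simps)
qed

lemmas cross_hom = cross_linear[THEN Vector_Spaces.linear.axioms(3)]

lemmas cross_simps =
  cross_hom(1)[THEN module_hom.add] cross_hom(2)[THEN module_hom.add]
  cross_hom(1)[THEN module_hom.diff] cross_hom(2)[THEN module_hom.diff]
  cross_hom(1)[THEN module_hom.scale] cross_hom(2)[THEN module_hom.scale]
  cross_hom(1)[THEN module_hom.zero] cross_hom(2)[THEN module_hom.zero]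

lemma cross_self: "cross x x = 0"
  by (rule \<beta>_eqI) (simp add: \<beta>_cross \<gamma>_alternating \<beta>_simps)

lemma cross_swap: "cross y x = - cross x y"
  by (rule \<beta>_eqI) (simp add: \<beta>_cross \<beta>_simps \<gamma>_swap12[of x y])

lemma cross_eq_0_iff: "cross x y = 0 \<longleftrightarrow> (\<forall>w. \<gamma> x y w = 0)"
proof
  assume "cross x y = 0"
  then show "\<forall>w. \<gamma> x y w = 0" by (simp add: \<beta>_cross[symmetric] \<beta>_simps)
next
  assume "\<forall>w. \<gamma> x y w = 0"
  then show "cross x y = 0" by (intro \<beta>_eqI) (simp add: \<beta>_cross \<beta>_simps)
qed

lemma \<beta>_cross_self: "2 * \<beta> (cross x y) (cross x y) = \<beta> x x * \<beta> y y - (\<beta> x y)\<^sup>2"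
  unfolding \<beta>_cross using compat[unfolded compatible_def, folded cross_def] by blast

text \<open>Polarization of compatibility in the second argument.\<close>
lemma \<beta>_cross_cross:
  "2 * \<beta> (cross x y) (cross x z) = \<beta> x x * \<beta> y z - \<beta> x y * \<beta> x z"
proof -
  have lhs: "2 * \<beta> (cross x (y + z)) (cross x (y + z)) = 2 * \<beta> (cross x y) (cross x y)
      + 2 * \<beta> (cross x z) (cross x z) + 2 * (2 * \<beta> (cross x y) (cross x z))"
    unfolding \<beta>_simps cross_simps \<beta>_commute[of "cross x z" "cross x y"] by algebra
  have rhs: "\<beta> x x * \<beta> (y + z) (y + z) - (\<beta> x (y + z))\<^sup>2 = (\<beta> x x * \<beta> y y - (\<beta> x y)\<^sup>2)
      + (\<beta> x x * \<beta> z z - (\<beta> x z)\<^sup>2) + 2 * (\<beta> x x * \<beta> y z - \<beta> x y * \<beta> x z)"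
    unfolding \<beta>_simps \<beta>_commute[of z y] by algebra
  have "2 * (2 * \<beta> (cross x y) (cross x z)) = 2 * (\<beta> x x * \<beta> y z - \<beta> x y * \<beta> x z)"
    using \<beta>_cross_self[of x "y + z"] unfolding lhs rhs unfolding \<beta>_cross_self add_left_cancel .
  then show ?thesis by (rule iffD1[OF mult_left_cancel[OF two]])
qed

text \<open>
  Compatibility as an identity between vectors: it is polarized, and since \<open>\<gamma>\<close> is alternating
  the operator \<open>cross x\<close> is skew for \<open>\<beta>\<close>, so it can be moved to one side. This is the alternative
  law \<open>x(xz) = (xx)z\<close> of the octonions, for \<open>x\<close> and \<open>z\<close> in \<open>V\<close>.
\<close>
lemma cross_cross: "scl 2 (cross x (cross x z)) = scl (\<beta> x z) x - scl (\<beta> x x) z"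
proof (rule \<beta>_eqI)
  fix w
  have "\<beta> (cross x (cross x z)) w = - \<beta> (cross x w) (cross x z)"
    by (simp add: \<beta>_cross \<gamma>_swap23[of x "cross x z" w])
  then show "\<beta> (scl 2 (cross x (cross x z))) w = \<beta> (scl (\<beta> x z) x - scl (\<beta> x x) z) w"
    using \<beta>_cross_cross[of x w z] \<beta>_commute[of z w] by (simp add: \<beta>_simps)
qed

lemma cross_cross_polarized:
  "scl 2 (cross x (cross y z)) + scl 2 (cross y (cross x z)) =
    scl (\<beta> x z) y + scl (\<beta> y z) x - scl (2 * \<beta> x y) z"
proof -
  have lhs: "scl 2 (cross (x + y) (cross (x + y) z)) =
      scl 2 (cross x (cross x z)) + scl 2 (cross y (cross y z)) +
      (scl 2 (cross x (cross y z)) + scl 2 (cross y (cross x z)))"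
    by (simp add: cross_simps scale_right_distrib add_ac)
  have rhs: "scl (\<beta> (x + y) z) (x + y) - scl (\<beta> (x + y) (x + y)) z =
      (scl (\<beta> x z) x - scl (\<beta> x x) z) + (scl (\<beta> y z) y - scl (\<beta> y y) z) +
      (scl (\<beta> x z) y + scl (\<beta> y z) x - scl (2 * \<beta> x y) z)"
    by (simp add: \<beta>_simps \<beta>_commute[of y x] scale_right_distrib scale_left_distrib scale_double)
  show ?thesis
    using cross_cross[of "x + y" z] unfolding lhs rhs unfolding cross_cross add_left_cancel .
qed

section \<open>Isotropic vectors and their annihilators\<close>

text \<open>
  For \<open>x \<times> y = 0\<close>, the identity \<open>cross_cross\<close> becomes a linear relation between \<open>x\<close> and \<open>y\<close>.
\<close>
lemma \<beta>_eq_0_if_cross_eq_0: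
  assumes ind: "independent {x, y}" "x \<noteq> y" and "cross x y = 0"
  shows "\<beta> x x = 0" "\<beta> x y = 0"
proof -
  have "scl (\<beta> x y) x + scl (- \<beta> x x) y = 0"
    using cross_cross[of x y] assms(3) by (simp add: cross_simps)
  then have 0: "(\<Sum>b\<in>{x, y}. scl (if b = x then \<beta> x y else - \<beta> x x) b) = 0"
    using ind(2) by auto
  show "\<beta> x x = 0" using independentD[OF ind(1) _ order_refl 0, of y] ind(2) by simp
  show "\<beta> x y = 0" using independentD[OF ind(1) _ order_refl 0, of x] ind(2) by simp
qed

lemma \<beta>_self_eq_0:
  assumes "u \<noteq> 0" "\<beta> u x = 0" "cross u x = 0"
  shows "\<beta> x x = 0"
  using cross_cross[of x u] assms cross_swap[of u x] by (simp add: cross_simps \<beta>_commute[of x u])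

text \<open>
  The three vectors span a totally isotropic space \<open>E\<close>, which is enlarged as follows. Choose \<open>z\<close>
  with \<open>\<beta>(u, z) \<noteq> 0\<close> and correct \<open>v\<close> by a multiple of \<open>u\<close> to a vector \<open>v'\<close> orthogonal to \<open>z\<close>. Then
  \<open>p = v' \<times> z\<close> is isotropic by compatibility, and orthogonal to \<open>E\<close> because \<open>E \<times> v' = 0\<close>. It lies
  outside \<open>E\<close>, since \<open>u \<times> p = \<beta>(u, z) v' \<noteq> 0\<close> whereas \<open>u \<times> E = 0\<close>. So \<open>E\<close> and \<open>p\<close> span a totally
  isotropic space of dimension four.
\<close>
lemma isotropic_triple_dim:
  assumes ind: "independent {u, v, w}" and card: "card {u, v, w} = 3"
    and uv: "cross u v = 0" and uw: "cross u w = 0" and vw: "cross v w = 0"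
  shows "8 \<le> dim (UNIV :: 'v set)"
proof -
  have neq: "u \<noteq> v" "u \<noteq> w" "v \<noteq> w" using card by (auto simp: card_insert_if split: if_splits)
  have sub: "independent {x, y}" if "{x, y} \<subseteq> {u, v, w}" for x y
    by (rule independent_mono[OF ind that])
  have vu: "cross v u = 0" and wu: "cross w u = 0" and wv: "cross w v = 0"
    using uv uw vw cross_swap[of v u] cross_swap[of w u] cross_swap[of w v] by simp_all
  have iso: "\<beta> u u = 0" "\<beta> u v = 0" "\<beta> u w = 0" "\<beta> v v = 0" "\<beta> v w = 0" "\<beta> w w = 0"
    using \<beta>_eq_0_if_cross_eq_0[OF sub _ uv] \<beta>_eq_0_if_cross_eq_0[OF sub _ uw]
      \<beta>_eq_0_if_cross_eq_0[OF sub _ vw] \<beta>_eq_0_if_cross_eq_0(1)[OF sub _ wv] neq by auto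
  have "u \<noteq> 0" using ind dependent_zero[of "{u, v, w}"] by auto
  then obtain z where z: "\<beta> u z \<noteq> 0"
    using \<beta>(2) by (auto simp: nondegenerate_def)
  define v' where "v' = v - scl (\<beta> v z / \<beta> u z) u"
  have v'z: "\<beta> v' z = 0" and v'v': "\<beta> v' v' = 0" and uv'b: "\<beta> u v' = 0"
    using z by (simp_all add: v'_def \<beta>_simps iso \<beta>_commute[of v u])
  have ev': "cross e v' = 0" if "e \<in> {u, v, w}" for e
    using that by (auto simp: v'_def cross_simps cross_self uv vu wu wv)
  then have uv': "cross u v' = 0" and v'u: "cross v' u = 0"
    using cross_swap[of v' u] by simp_all
  have "v' \<noteq> 0"
  proof
    assume "v' = 0"
    then have "v \<in> span {u}" by (auto simp: v'_def span_singleton)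
    moreover have "v \<notin> span ({v, u} - {v})"
      using sub[of v u] by (auto simp: dependent_def)
    ultimately show False using neq by (simp add: insert_Diff_if)
  qed
  define p where "p = cross v' z"
  \<comment> \<open>The identity for \<open>v'\<close>, \<open>z\<close>, \<open>u\<close> gives \<open>v' \<times> (u \<times> z)\<close>, the term that accompanies \<open>u \<times> p\<close>
    in the identity for \<open>u\<close>, \<open>v'\<close>, \<open>z\<close>.\<close>
  have "scl 2 (cross v' (cross z u)) = scl (\<beta> u z) v'"
    using cross_cross_polarized[of v' z u]
    by (simp add: v'u cross_simps v'z \<beta>_commute[of v' u] uv'b \<beta>_commute[of z u])
  then have "scl 2 (cross v' (cross u z)) = - scl (\<beta> u z) v'"
    by (simp add: cross_swap[of u z] cross_hom(2)[THEN module_hom.neg])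
  then have "scl 2 (cross u p) = scl (\<beta> u z) v' + scl (\<beta> u z) v'"
    using cross_cross_polarized[of u v' z] by (simp add: p_def v'z uv'b algebra_simps)
  then have "scl 2 (cross u p) = scl 2 (scl (\<beta> u z) v')"
    by (simp add: scale_double)
  then have "cross u p \<noteq> 0" using two z \<open>v' \<noteq> 0\<close> by auto
  have "p \<notin> span {u, v, w}"
  proof
    assume "p \<in> span {u, v, w}"
    then have "cross u p = 0"
      by (rule module_hom.eq_0_on_span[OF cross_hom(2), rotated])
        (auto simp: cross_self uv uw)
    with \<open>cross u p \<noteq> 0\<close> show False ..
  qed
  then have "independent {p, u, v, w}" and "p \<notin> {u, v, w}"
    by (rule independent_insertI[OF _ ind], rule contrapos_nn[OF _ span_base])
  then have "card {p, u, v, w} = 4" using card by simp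
  have pe: "\<beta> p e = 0" if "e \<in> {u, v, w}" for e
  proof -
    have "\<beta> p e = - \<gamma> v' e z" by (simp add: p_def \<beta>_cross \<gamma>_swap23[of v' e z])
    also have "\<dots> = \<beta> (cross e v') z" by (simp add: \<beta>_cross \<gamma>_swap12[of v' e z])
    finally show ?thesis by (simp add: ev'[OF that] \<beta>_simps)
  qed
  have pp: "\<beta> p p = 0"
    using \<beta>_cross_self[of v' z] two by (simp add: p_def v'v' v'z)
  have "\<beta> x y = 0" if "x \<in> {p, u, v, w}" "y \<in> {p, u, v, w}" for x y
    using that pe[of u] pe[of v] pe[of w] pp iso \<beta>_commute[of u p] \<beta>_commute[of v p]
      \<beta>_commute[of w p] \<beta>_commute[of v u] \<beta>_commute[of w u] \<beta>_commute[of w v] by auto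
  from totally_isotropic_card[OF \<open>independent {p, u, v, w}\<close> this] show ?thesis
    using \<open>card {p, u, v, w} = 4\<close> by simp
qed

text \<open>
  All of \<open>E = {x. u \<times> x = 0}\<close> is isotropic, hence \<open>\<beta>(v, w) = 0\<close>, and polarization puts \<open>v \<times> w\<close>
  into \<open>E\<close>. Its coordinates along \<open>v\<close> and \<open>w\<close> vanish because \<open>v \<times> (v \<times> w)\<close> and
  \<open>w \<times> (v \<times> w)\<close> do.
\<close>
lemma annihilator_cross:
  assumes ind: "independent {u, v, w}" and card: "card {u, v, w} = 3"
    and E: "{x. cross u x = 0} = span {u, v, w}"
    and dim: "dim (UNIV :: 'v set) < 8"
  shows "\<exists>a. a \<noteq> 0 \<and> cross v w = scl a u"
proof -
  have neq: "u \<noteq> v" "u \<noteq> w" using card by (auto simp: card_insert_if split: if_splits)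
  have u: "u \<noteq> 0" using ind dependent_zero[of "{u, v, w}"] by auto
  have uv: "cross u v = 0" and uw: "cross u w = 0"
    using E span_base[of _ "{u, v, w}"] by blast+
  have b: "\<beta> u v = 0" "\<beta> u w = 0"
    using \<beta>_eq_0_if_cross_eq_0(2)[of u v] \<beta>_eq_0_if_cross_eq_0(2)[of u w] neq uv uw
      independent_mono[OF ind, of "{u, v}"] independent_mono[OF ind, of "{u, w}"] by auto
  have vv: "\<beta> v v = 0" and ww: "\<beta> w w = 0" and "\<beta> (v + w) (v + w) = 0"
    by (rule \<beta>_self_eq_0[OF u]; simp only: b uv uw cross_simps \<beta>_simps add_0)+
  then have "2 * \<beta> v w = 0"
    by (simp add: \<beta>_simps \<beta>_commute[of w v])
  then have bvw: "\<beta> v w = 0" using two by simp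
  have "cross u (cross v w) = 0"
    by (rule scale_two_eq_0)
      (use cross_cross_polarized[of u v w] in \<open>simp add: uw b bvw cross_simps\<close>)
  then have "cross v w \<in> span {u, v, w}" using E by blast
  then obtain a b' c where abc: "cross v w = scl a u + (scl b' v + scl c w)"
    by (auto simp: span_insert span_singleton diff_eq_eq add_ac)
  have nz: "cross v w \<noteq> 0"
    using isotropic_triple_dim[OF ind card uv uw] dim by auto
  have "cross v (cross v w) = 0" "cross w (cross w v) = 0"
    by (rule scale_two_eq_0; simp add: cross_cross vv ww bvw \<beta>_commute[of w v])+
  then have 0: "cross v (cross v w) = 0" "cross w (cross v w) = 0"
    by (simp_all add: cross_swap[of v w] cross_hom(2)[THEN module_hom.neg])
  have "cross v u = 0" "cross w u = 0"
    using uv uw cross_swap[of v u] cross_swap[of w u] by simp_all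
  moreover have "cross v (scl a u + (scl b' v + scl c w)) = 0"
    "cross w (scl a u + (scl b' v + scl c w)) = 0"
    using 0 abc by simp_all
  ultimately have "scl c (cross v w) = 0" "scl b' (cross w v) = 0"
    by (simp_all add: cross_simps cross_self)
  then have "c = 0" "b' = 0" using nz cross_swap[of w v] by auto
  with abc nz show ?thesis by auto
qed

section \<open>Automorphisms\<close>

text \<open>
  An automorphism fixes the identity \<open>e\<close>, so it acts as \<open>a e + z \<mapsto> a e + g z\<close>. The product formula
  for \<open>C\<close> then shows that \<open>g\<close> respects the \<open>V\<close>-component \<open>x \<times> y\<close> of a product in \<open>V\<close>.
\<close>
lemma act_automorphism:
  assumes g: "g \<in> oct_aut scl \<beta> \<gamma>"
  shows act_linear: "Vector_Spaces.linear scl scl (act g)"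
    and act_inj: "inj (act g)"
    and act_cross: "\<And>x y. act g (cross x y) = cross (act g x) (act g y)"
proof -
  interpret P: vector_space_prod "(*)" scl
    by (intro vector_space_prod.intro vector_space_pair.intro vector_space_axioms)
      (unfold_locales, auto simp: algebra_simps)
  let ?m = "oct_mult scl \<beta> \<gamma>"
  have lin: "Vector_Spaces.linear P.scale P.scale g" and bij: "bij g"
    and mult: "g (?m x y) = ?m (g x) (g y)" for x y
    using g unfolding oct_aut_def by blast+
  interpret g: Vector_Spaces.linear P.scale P.scale g by (rule lin)
  note act = oct_aut_act[OF char \<beta> \<gamma> g]
  show "Vector_Spaces.linear scl scl (act g)"
  proof (rule endomorphismI)
    show "act g (x + y) = act g x + act g y" for x y
      using g.add[of "(0, x)" "(0, y)"] by (simp add: act)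
    show "act g (scl c x) = scl c (act g x)" for c x
      using g.scale[of c "(0, x)"] by (simp add: act P.scale_def)
  qed
  show "inj (act g)"
    by (rule injI) (metis act bij bij_def inj_eq prod.inject)
  have m: "?m x y = (fst x * fst y - \<beta> (snd x) (snd y) / 2,
      scl (fst x) (snd y) + scl (fst y) (snd x) + cross (snd x) (snd y))" for x y
    by (simp add: oct_mult_def cross_def)
  have e: "?m (1, 0) x = x" "?m x (1, 0) = x" for x
    by (simp_all add: m \<beta>_simps cross_simps)
  obtain y where "g y = (1, 0)" using bij by (metis bij_pointE)
  then have ge: "g (1, 0) = (1, 0)" using mult[of "(1, 0)" y] e by metis
  have "g (c, z) = (c, act g z)" for c z
    using g.add[of "(c, 0)" "(0, z)"] g.scale[of c "(1, 0)"] by (simp add: P.scale_def ge act)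
  then show "act g (cross x y) = cross (act g x) (act g y)" for x y
    using mult[of "(0, x)" "(0, y)"] by (simp add: m)
qed

end

theorem corollary3p12:
  fixes scl :: "'k::alg_closed_field \<Rightarrow> 'v::ab_group_add \<Rightarrow> 'v"
    and \<beta> :: "'v \<Rightarrow> 'v \<Rightarrow> 'k"
    and \<gamma> :: "'v \<Rightarrow> 'v \<Rightarrow> 'v \<Rightarrow> 'k"
    and L :: "nat \<Rightarrow> 'v set"
    and u :: 'v
  assumes "CHAR('k) \<noteq> 2"
    and "vector_space scl"
    and "vector_space.dim scl (UNIV :: 'v set) = 7"
    and "symmetric_bilinear_form scl \<beta>"
    and "nondegenerate \<beta>"
    and "alternating_trilinear_form scl \<gamma>"
    and "compatible \<beta> \<gamma>"
    and "splitting scl {1..7} L"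
    and "\<forall>i\<in>{1..7}. vector_space.dim scl (L i) = 1"
    and "gamma_isotropic scl \<gamma> (L 1)"
    and "u \<in> L 1" and "u \<noteq> 0"
    and "L 1 + L 2 + L 3 = E_space scl \<gamma> u"
  shows "tensor_iso scl (gamma_map scl \<beta> \<gamma>) (subspace_tensor scl (L 2) (L 3)) (L 1) \<and>
    (\<forall>g\<in>oct_aut scl \<beta> \<gamma>.
      (\<forall>X\<in>tensor_space scl.
         gamma_map scl \<beta> \<gamma> (tensor_square scl (act g) X) = act g (gamma_map scl \<beta> \<gamma> X)) \<and>
      bij_betw (tensor_square scl (act g))
        (subspace_tensor scl (L 2) (L 3))
        (subspace_tensor scl (act g ` L 2) (act g ` L 3)) \<and>
      tensor_iso scl (gamma_map scl \<beta> \<gamma>)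
        (subspace_tensor scl (act g ` L 2) (act g ` L 3)) (act g ` L 1))"
proof -
  interpret vector_space scl by fact
  have dim: "dim (UNIV :: 'v set) = 7" by fact
  have fin: "\<exists>B. finite B \<and> span B = (UNIV :: 'v set)"
  proof -
    obtain B where "(UNIV :: 'v set) \<subseteq> span B" "card B = dim (UNIV :: 'v set)"
      using basis_exists[of UNIV] by blast
    then have "finite B" "span B = UNIV" using dim by (auto intro: card_ge_0_finite)
    then show ?thesis by blast
  qed
  interpret compatible_forms scl \<beta> \<gamma>
    using fin assms(1,4-7) by unfold_locales
  \<comment> \<open>Generators of the seven lines, with the given \<open>u\<close> as the first one.\<close>
  let ?b = "\<lambda>i. if i = 1 then u else SOME l. l \<noteq> 0 \<and> L i = span {l}"
  have line: "?b i \<noteq> 0 \<and> L i = span {?b i}" if i: "i \<in> {1..7}" for i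
  proof -
    have ex: "\<exists>l. l \<noteq> 0 \<and> L i = span {l}"
      using i assms(8,9) by (intro line_eq_span) (auto simp: splitting_def)
    show ?thesis
    proof (cases "i = 1")
      case True
      then show ?thesis using ex assms(11,12) span_singleton_eqI[of u] by auto
    next
      case False
      then show ?thesis using someI_ex[OF ex] by simp
    qed
  qed
  define v where "v = ?b 2"
  define w where "w = ?b 3"
  have L1: "L 1 = span {u}" and L2: "L 2 = span {v}" and L3: "L 3 = span {w}"
    using line[of 1] line[of 2] line[of 3] by (simp_all add: v_def w_def)
  have ind: "independent (?b ` {1..7})" and inj: "inj_on ?b {1..7}"
    using splitting_independent[OF assms(8), of ?b] line span_base by blast+
  have img: "{u, v, w} = ?b ` {1, 2, 3}" by (auto simp: v_def w_def)
  have "independent {u, v, w}"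
    unfolding img by (rule independent_mono[OF ind]) auto
  moreover have "card {u, v, w} = 3"
    unfolding img by (subst card_image[OF inj_on_subset[OF inj]]) auto
  moreover have "{x. cross u x = 0} = span {u, v, w}"
  proof -
    have "{x. cross u x = 0} = L 1 + L 2 + L 3"
      using E_space_eq[OF assms(2,6,12)] assms(10,13) L1 by (simp add: cross_eq_0_iff)
    also have "\<dots> = span ({u} \<union> {v} \<union> {w})"
      unfolding L1 L2 L3 span_Un by (auto simp: set_plus_def)
    finally show ?thesis by (simp add: insert_commute)
  qed
  ultimately obtain a where a: "a \<noteq> 0" "cross v w = scl a u"
    using annihilator_cross[of u v w] dim by auto
  have nz: "cross v w \<noteq> 0" using a assms(12) by simp
  have L1': "L 1 = span {cross v w}"
    unfolding L1 by (rule span_singleton_eqI) (use a nz in \<open>auto simp: span_singleton\<close>)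
  have \<gamma>_map: "gamma_map scl \<beta> \<gamma> = tensor_lift scl cross"
    by (simp add: gamma_map_def cross_def[abs_def])
  note iso = tensor_iso_lines[where b = cross, OF assms(2) cross_linear]
  have iso0: "tensor_iso scl (tensor_lift scl cross) (subspace_tensor scl (L 2) (L 3)) (L 1)"
    unfolding L1' L2 L3 by (rule iso[OF nz])
  have "(\<forall>X\<in>tensor_space scl.
         tensor_lift scl cross (tensor_square scl (act g) X) = act g (tensor_lift scl cross X)) \<and>
      bij_betw (tensor_square scl (act g))
        (subspace_tensor scl (L 2) (L 3))
        (subspace_tensor scl (act g ` L 2) (act g ` L 3)) \<and>
      tensor_iso scl (tensor_lift scl cross)
        (subspace_tensor scl (act g ` L 2) (act g ` L 3)) (act g ` L 1)"
    if g: "g \<in> oct_aut scl \<beta> \<gamma>" for g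
  proof -
    interpret g: Vector_Spaces.linear scl scl "act g" by (rule act_linear[OF g])
    have equi: "\<forall>X\<in>tensor_space scl.
        tensor_lift scl cross (tensor_square scl (act g) X) = act g (tensor_lift scl cross X)"
      by (rule ballI)
        (rule tensor_lift_equivariant[where b = cross,
          OF assms(2) cross_linear act_linear[OF g] act_cross[OF g]])
    have gL: "act g ` L 1 = span {cross (act g v) (act g w)}"
      "act g ` L 2 = span {act g v}" "act g ` L 3 = span {act g w}"
      unfolding L1' L2 L3 g.span_image[symmetric] by (simp_all add: act_cross[OF g])
    have "act g (cross v w) \<noteq> 0"
      using nz act_inj[OF g] unfolding g.inj_iff_eq_0 by blast
    then have "cross (act g v) (act g w) \<noteq> 0" by (simp add: act_cross[OF g])
    then have iso_g: "tensor_iso scl (tensor_lift scl cross)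
        (subspace_tensor scl (act g ` L 2) (act g ` L 3)) (act g ` L 1)"
      unfolding gL by (rule iso)
    let ?T = "subspace_tensor scl (L 2) (L 3)"
    \<comment> \<open>After the map to \<open>V\<close>, \<open>g \<otimes> g\<close> becomes the injective map \<open>g\<close> on \<open>L 1\<close>.\<close>
    have "inj_on (tensor_square scl (act g)) ?T"
    proof (rule inj_onI)
      fix X Y assume XY: "X \<in> ?T" "Y \<in> ?T" "tensor_square scl (act g) X = tensor_square scl (act g) Y"
      have "X \<in> tensor_space scl" "Y \<in> tensor_space scl"
        using XY(1,2) by (auto simp: subspace_tensor_def tensor_space_def)
      then have "act g (tensor_lift scl cross X) = act g (tensor_lift scl cross Y)"
        using equi XY(3) by metis
      then have "tensor_lift scl cross X = tensor_lift scl cross Y"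
        by (rule injD[OF act_inj[OF g]])
      moreover have "inj_on (tensor_lift scl cross) ?T"
        using iso0 by (simp add: tensor_iso_def bij_betw_def)
      ultimately show "X = Y" using XY(1,2) by (simp add: inj_on_eq_iff)
    qed
    moreover have "tensor_square scl (act g) ` ?T =
        subspace_tensor scl (act g ` L 2) (act g ` L 3)"
      unfolding gL unfolding L2 L3 subspace_tensor_lines[OF assms(2)] image_image
        tensor_square_line[OF act_linear[OF g]] ..
    ultimately have "bij_betw (tensor_square scl (act g)) ?T
        (subspace_tensor scl (act g ` L 2) (act g ` L 3))"
      by (simp add: bij_betw_def)
    with equi iso_g show ?thesis by simp
  qed
  with iso0 show ?thesis unfolding \<gamma>_map by simp
qed

end
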